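(* Let $M \in \mathrm{Sp}(2n;\mathbb{R})$ be diagonalizable (over $\mathbb{C}$) with mutually distinct eigenvalues, all on the unit circle, let $V \in \mathrm{Sp}(2n;\mathbb{R})$ be a linear normal form map for $M$, and let $G \in \mathbb{R}^{2n\times 2n}$ be symmetric. Then $M G M^{tr} = G$ if and only if there exists a real diagonal matrix $D = \mathrm{diag}(\Lambda,\Lambda)$ with $\Lambda = \mathrm{diag}(b_1,\dots,b_n)$ such that $G = V D V^{tr}$.
   Context: $J = \begin{pmatrix} 0 & 1_n \\ -1_n & 0\end{pmatrix}$, and $\mathrm{Sp}(2n;\mathbb{R})$ is the group of real $2n \times 2n$ matrices $S$ with $S^{tr} J S = J$. A linear normal form map for $M$ is a matrix $V \in \mathrm{Sp}(2n;\mathbb{R})$ such that $R := V^{-1} M V$ leaves every plane $E_k := \mathrm{span}\{e_k, e_{n+k}\}$, $k=1,\dots,n$, invariant and acts on it, in the basis $(e_k,e_{n+k})$, by the rotation matrix $\begin{pmatrix} \cos\varphi_k & \sin\varphi_k \\ -\sin\varphi_k & \cos\varphi_k\end{pmatrix}$ for some $\varphi_k \in [0,2\pi)$. (Such a $V$ exists for every $M$ as in the claim; the numbers $e^{\pm i\varphi_k}$ are the eigenvalues of $M$.) *)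

theory Defs
  imports "Jordan_Normal_Form.Spectral_Radius"
begin

definition sympl_J :: "nat \<Rightarrow> real mat" where
  "sympl_J n = four_block_mat (0\<^sub>m n n) (1\<^sub>m n) (- 1\<^sub>m n) (0\<^sub>m n n)"

definition Sp :: "nat \<Rightarrow> real mat set" where
  "Sp n = {S \<in> carrier_mat (2 * n) (2 * n). transpose_mat S * sympl_J n * S = sympl_J n}"

definition diagonalizable :: "'a :: field mat \<Rightarrow> bool" where
  "diagonalizable A \<longleftrightarrow> (\<exists>D. diagonal_mat D \<and> similar_mat A D)"

(* Only meaningful for invertible A; otherwise mat_inverse A = None. *)
definition mat_inv :: "'a :: field mat \<Rightarrow> 'a mat" where
  "mat_inv A = the (mat_inverse A)"

(* Basis vectors are indexed from 0, so the k-th plane is spanned by e_k and e_(n+k) for k < n.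
   The two equations read off the columns of the rotation matrix
   (cos phi, sin phi; -sin phi, cos phi); they include the invariance of the plane. *)
definition rotates_plane :: "nat \<Rightarrow> real mat \<Rightarrow> nat \<Rightarrow> real \<Rightarrow> bool" where
  "rotates_plane n R k \<phi> \<longleftrightarrow>
     R *\<^sub>v unit_vec (2 * n) k =
       cos \<phi> \<cdot>\<^sub>v unit_vec (2 * n) k + (- sin \<phi>) \<cdot>\<^sub>v unit_vec (2 * n) (n + k) \<and>
     R *\<^sub>v unit_vec (2 * n) (n + k) =
       sin \<phi> \<cdot>\<^sub>v unit_vec (2 * n) k + cos \<phi> \<cdot>\<^sub>v unit_vec (2 * n) (n + k)"

definition linear_normal_form_map :: "nat \<Rightarrow> real mat \<Rightarrow> real mat \<Rightarrow> bool" where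
  "linear_normal_form_map n M V \<longleftrightarrow>
     V \<in> Sp n \<and>
     (\<forall>k<n. \<exists>\<phi>. 0 \<le> \<phi> \<and> \<phi> < 2 * pi \<and> rotates_plane n (mat_inv V * M * V) k \<phi>)"

definition double_diag :: "nat \<Rightarrow> (nat \<Rightarrow> real) \<Rightarrow> real mat" where
  "double_diag n b = four_block_mat (mat_diag n b) (0\<^sub>m n n) (0\<^sub>m n n) (mat_diag n b)"

lemma Sp_mat_inv:
  assumes "V \<in> Sp n"
  shows "mat_inv V \<in> carrier_mat (2 * n) (2 * n)"
    and "mat_inv V * V = 1\<^sub>m (2 * n)" and "V * mat_inv V = 1\<^sub>m (2 * n)"
proof -
  let ?J = "sympl_J n" and ?K = "four_block_mat (0\<^sub>m n n) (- 1\<^sub>m n) (1\<^sub>m n) (0\<^sub>m n n) :: real mat"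
  have V: "V \<in> carrier_mat (2 * n) (2 * n)" and eq: "transpose_mat V * ?J * V = ?J"
    using assms by (auto simp: Sp_def)
  have J: "?J \<in> carrier_mat (2 * n) (2 * n)" and K: "?K \<in> carrier_mat (2 * n) (2 * n)"
    by (auto simp: sympl_J_def mult_2)
  have neg_zero: "- 0\<^sub>m n n = (0\<^sub>m n n :: real mat)" by (rule eq_matI) auto
  have KJ: "?K * ?J = 1\<^sub>m (2 * n)"
    unfolding sympl_J_def
    by (subst mult_four_block_mat[of _ n n _ n _ n _ _ n _ n])
       (auto simp: mult_2 four_block_one_mat neg_zero)
  let ?W = "?K * (transpose_mat V * ?J)"
  have W: "?W \<in> carrier_mat (2 * n) (2 * n)" using V J K by auto
  have "?W * V = ?K * (transpose_mat V * ?J * V)"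
    using V J K by (intro assoc_mult_mat) auto
  then have WV: "?W * V = 1\<^sub>m (2 * n)" using eq KJ by simp
  have VW: "V * ?W = 1\<^sub>m (2 * n)" by (rule mat_mult_left_right_inverse[OF W V WV])
  have "V \<in> Units (ring_mat TYPE(real) (2 * n) ())"
    using V W WV VW by (auto simp: Units_def ring_mat_def)
  then obtain B where B: "mat_inverse V = Some B"
    using mat_inverse(1)[OF V, where b = "()"] by (cases "mat_inverse V") auto
  from mat_inverse(2)[OF V B] show "mat_inv V \<in> carrier_mat (2 * n) (2 * n)"
    and "mat_inv V * V = 1\<^sub>m (2 * n)" and "V * mat_inv V = 1\<^sub>m (2 * n)"
    by (auto simp: mat_inv_def B)
qed

end

theory Submission
  imports Defs
begin

text \<open>Conjugating by \<open>V\<close> turns the equation into \<open>R * H * R\<^sup>T = H\<close> with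
  \<open>R = V\<^sup>-\<^sup>1 * M * V\<close> and \<open>H = V\<^sup>-\<^sup>1 * G * V\<^sup>-\<^sup>T\<close>. On the \<open>(j, k)\<close> block of \<open>H\<close>, with
  rows \<open>(a, b)\<close> and \<open>(c, d)\<close>, this equation multiplies the complex numbers
  \<open>(a - d) + \<i> (b + c)\<close> and \<open>(a + d) + \<i> (c - b)\<close> by unimodular factors that differ from 1
  (the second one only for \<open>j \<noteq> k\<close>) because the \<open>2 * n\<close> numbers \<open>e\<^bsup>\<plusminus>\<i>\<phi>\<^esup>\<close> are distinct. So the
  off-diagonal blocks vanish and, by symmetry, the diagonal ones are scalar.\<close>

section \<open>Coordinates of the rotation normal form\<close>

lemma scalar_prod_two_support:
  fixes u v :: "'a :: semiring_0 vec"
  assumes "v \<in> carrier_vec N" and "p < N" "q < N" "p \<noteq> q"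
    and "\<And>i. i < N \<Longrightarrow> i \<noteq> p \<Longrightarrow> i \<noteq> q \<Longrightarrow> u $ i = 0"
  shows "u \<bullet> v = u $ p * v $ p + u $ q * v $ q"
proof -
  have "u \<bullet> v = (\<Sum>i\<in>{0..<N}. u $ i * v $ i)"
    using assms(1) by (simp add: scalar_prod_def)
  also have "\<dots> = (\<Sum>i\<in>{p, q}. u $ i * v $ i)"
    using assms by (intro sum.mono_neutral_right) auto
  finally show ?thesis using assms(4) by simp
qed

text \<open>Written entrywise so that the support of each row, the indices k and n + k of a single
  plane, can be read off directly.\<close>

definition plane_rotations :: "nat \<Rightarrow> (nat \<Rightarrow> real) \<Rightarrow> real mat" where
  "plane_rotations n \<phi> = mat (2 * n) (2 * n) (\<lambda>(i, j).
     if i < n then (if j = i then cos (\<phi> i) else if j = n + i then sin (\<phi> i) else 0)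
     else (if j = i then cos (\<phi> (i - n)) else if j = i - n then - sin (\<phi> (i - n)) else 0))"

lemma plane_rotations_carrier [simp]: "plane_rotations n \<phi> \<in> carrier_mat (2 * n) (2 * n)"
  by (simp add: plane_rotations_def)

lemma dim_plane_rotations [simp]:
  "dim_row (plane_rotations n \<phi>) = 2 * n" "dim_col (plane_rotations n \<phi>) = 2 * n"
  by (simp_all add: plane_rotations_def)

text \<open>The n planes together contain every unit vector, so the rotation conditions fix all
  columns of \<open>R\<close>.\<close>

lemma eq_plane_rotationsI:
  assumes R: "R \<in> carrier_mat (2 * n) (2 * n)"
    and rot: "\<And>k. k < n \<Longrightarrow> rotates_plane n R k (\<phi> k)"
  shows "R = plane_rotations n \<phi>"
proof (rule eq_matI)
  fix i j assume "i < dim_row (plane_rotations n \<phi>)" "j < dim_col (plane_rotations n \<phi>)"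
  then have ij: "i < 2 * n" "j < 2 * n" by auto
  have entry: "R $$ (i, l) = (R *\<^sub>v unit_vec (2 * n) l) $ i" if "l < 2 * n" for l
    using R ij that by (simp add: row_def)
  show "R $$ (i, j) = plane_rotations n \<phi> $$ (i, j)"
  proof (cases "j < n")
    case True
    then show ?thesis
      using ij rot[of j] entry[of j] by (auto simp: rotates_plane_def plane_rotations_def)
  next
    case False
    then have "j = n + (j - n)" "j - n < n" using ij by auto
    then obtain k where "j = n + k" "k < n" by blast
    then show ?thesis
      using ij rot[of k] entry[of j] by (auto simp: rotates_plane_def plane_rotations_def)
  qed
qed (use R in auto)

lemma plane_rotations_row_upper:
  assumes "v \<in> carrier_vec (2 * n)" "k < n"
  shows "row (plane_rotations n \<phi>) k \<bullet> v = cos (\<phi> k) * v $ k + sin (\<phi> k) * v $ (n + k)"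
proof -
  have "row (plane_rotations n \<phi>) k \<bullet> v = row (plane_rotations n \<phi>) k $ k * v $ k
      + row (plane_rotations n \<phi>) k $ (n + k) * v $ (n + k)"
    by (rule scalar_prod_two_support[of _ "2 * n"]) (use assms in \<open>simp_all add: plane_rotations_def\<close>)
  then show ?thesis using assms(2) by (simp add: plane_rotations_def)
qed

lemma plane_rotations_row_lower:
  assumes "v \<in> carrier_vec (2 * n)" "k < n"
  shows "row (plane_rotations n \<phi>) (n + k) \<bullet> v = - sin (\<phi> k) * v $ k + cos (\<phi> k) * v $ (n + k)"
proof -
  have "row (plane_rotations n \<phi>) (n + k) \<bullet> v = row (plane_rotations n \<phi>) (n + k) $ k * v $ k
      + row (plane_rotations n \<phi>) (n + k) $ (n + k) * v $ (n + k)"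
    by (rule scalar_prod_two_support[of _ "2 * n"]) (use assms in \<open>simp_all add: plane_rotations_def\<close>)
  then show ?thesis using assms(2) by (simp add: plane_rotations_def)
qed

text \<open>The rotations do not mix different planes, so block (j, k) of \<open>Y\<close> is block
  (j, k) of \<open>X\<close> multiplied by the j-th rotation on the left and the transposed k-th
  rotation on the right. For a fixed \<open>X\<close>, these are the four equations that the block
  lemmas below assume.\<close>

lemma plane_rotations_congruence_entries:
  fixes X :: "real mat" and j k n :: nat and \<phi> :: "nat \<Rightarrow> real"
  assumes X: "X \<in> carrier_mat (2 * n) (2 * n)" and jk: "j < n" "k < n"
  defines "Y \<equiv> plane_rotations n \<phi> * X * transpose_mat (plane_rotations n \<phi>)"
    and "a \<equiv> X $$ (j, k)" and "b \<equiv> X $$ (j, n + k)"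
    and "c \<equiv> X $$ (n + j, k)" and "d \<equiv> X $$ (n + j, n + k)"
  shows "Y $$ (j, k) = cos (\<phi> k) * (cos (\<phi> j) * a + sin (\<phi> j) * c)
           + sin (\<phi> k) * (cos (\<phi> j) * b + sin (\<phi> j) * d)"
    and "Y $$ (j, n + k) = - sin (\<phi> k) * (cos (\<phi> j) * a + sin (\<phi> j) * c)
           + cos (\<phi> k) * (cos (\<phi> j) * b + sin (\<phi> j) * d)"
    and "Y $$ (n + j, k) = cos (\<phi> k) * (- sin (\<phi> j) * a + cos (\<phi> j) * c)
           + sin (\<phi> k) * (- sin (\<phi> j) * b + cos (\<phi> j) * d)"
    and "Y $$ (n + j, n + k) = - sin (\<phi> k) * (- sin (\<phi> j) * a + cos (\<phi> j) * c)
           + cos (\<phi> k) * (- sin (\<phi> j) * b + cos (\<phi> j) * d)"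
proof -
  let ?R = "plane_rotations n \<phi>"
  have upper: "(?R * X) $$ (j, l) = cos (\<phi> j) * X $$ (j, l) + sin (\<phi> j) * X $$ (n + j, l)"
    if "l < 2 * n" for l
    using X jk that plane_rotations_row_upper[of "col X l" n j \<phi>] by simp
  have lower: "(?R * X) $$ (n + j, l) = - sin (\<phi> j) * X $$ (j, l) + cos (\<phi> j) * X $$ (n + j, l)"
    if "l < 2 * n" for l
    using X jk that plane_rotations_row_lower[of "col X l" n j \<phi>] by simp
  \<comment> \<open>The factors are swapped to bring the rotation row to the left, where the two row
    lemmas expect it.\<close>
  have Y: "Y $$ (i, l) = row ?R l \<bullet> row (?R * X) i" if "i < 2 * n" "l < 2 * n" for i l
  proof -
    have "Y $$ (i, l) = row (?R * X) i \<bullet> row ?R l"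
      using X that by (simp add: Y_def)
    also have "\<dots> = row ?R l \<bullet> row (?R * X) i"
      by (rule comm_scalar_prod[of _ "2 * n"]; rule carrier_vecI) (use X in simp_all)
    finally show ?thesis .
  qed
  have row: "row (?R * X) i \<in> carrier_vec (2 * n)" for i
    by (rule carrier_vecI) (use X in simp)
  have entry: "row (?R * X) i $ l = (?R * X) $$ (i, l)" if "i < 2 * n" "l < 2 * n" for i l
    using X that by simp
  show "Y $$ (j, k) = cos (\<phi> k) * (cos (\<phi> j) * a + sin (\<phi> j) * c)
           + sin (\<phi> k) * (cos (\<phi> j) * b + sin (\<phi> j) * d)"
    using jk by (simp add: Y plane_rotations_row_upper row entry upper a_def b_def c_def d_def
      del: index_mult_mat index_row)
  show "Y $$ (j, n + k) = - sin (\<phi> k) * (cos (\<phi> j) * a + sin (\<phi> j) * c)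
           + cos (\<phi> k) * (cos (\<phi> j) * b + sin (\<phi> j) * d)"
    using jk by (simp add: Y plane_rotations_row_lower row entry upper a_def b_def c_def d_def
      del: index_mult_mat index_row)
  show "Y $$ (n + j, k) = cos (\<phi> k) * (- sin (\<phi> j) * a + cos (\<phi> j) * c)
           + sin (\<phi> k) * (- sin (\<phi> j) * b + cos (\<phi> j) * d)"
    using jk by (simp add: Y plane_rotations_row_upper row entry lower a_def b_def c_def d_def
      del: index_mult_mat index_row)
  show "Y $$ (n + j, n + k) = - sin (\<phi> k) * (- sin (\<phi> j) * a + cos (\<phi> j) * c)
           + cos (\<phi> k) * (- sin (\<phi> j) * b + cos (\<phi> j) * d)"
    using jk by (simp add: Y plane_rotations_row_lower row entry lower a_def b_def c_def d_def
      del: index_mult_mat index_row)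
qed

section \<open>Eigenvalues and their distinctness\<close>

text \<open>An eigenvector has a nonzero component in some plane, and that component is an
  eigenvector of the 2 by 2 rotation there. The inclusion suffices for the counting argument that
  follows.\<close>

lemma spectrum_plane_rotations:
  "spectrum (map_mat complex_of_real (plane_rotations n \<phi>))
     \<subseteq> (\<lambda>k. cis (\<phi> k)) ` {..<n} \<union> (\<lambda>k. cis (- \<phi> k)) ` {..<n}"
proof
  let ?R = "map_mat complex_of_real (plane_rotations n \<phi>)"
  fix z assume "z \<in> spectrum ?R"
  then obtain x where x: "x \<in> carrier_vec (2 * n)" "x \<noteq> 0\<^sub>v (2 * n)"
    and eig: "?R *\<^sub>v x = z \<cdot>\<^sub>v x"
    by (auto simp: spectrum_def eigenvalue_def eigenvector_def)
  obtain i where i: "i < 2 * n" "x $ i \<noteq> 0"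
    using x by (metis carrier_vecD eq_vecI index_zero_vec)
  define k where "k = (if i < n then i else i - n)"
  have k: "k < n" using i by (auto simp: k_def)
  have nz: "x $ k \<noteq> 0 \<or> x $ (n + k) \<noteq> 0"
    using i by (auto simp: k_def split: if_splits)
  define c s where "c = complex_of_real (cos (\<phi> k))" and "s = complex_of_real (sin (\<phi> k))"
  have "(?R *\<^sub>v x) $ k = c * x $ k + s * x $ (n + k)"
    using k x(1) by (subst index_mult_mat_vec, simp,
      subst scalar_prod_two_support[of _ "2 * n" k "n + k"])
      (auto simp: plane_rotations_def c_def s_def)
  then have e1: "c * x $ k + s * x $ (n + k) = z * x $ k"
    using k x(1) by (simp add: eig)
  have "(?R *\<^sub>v x) $ (n + k) = - s * x $ k + c * x $ (n + k)"
    using k x(1) by (subst index_mult_mat_vec, simp,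
      subst scalar_prod_two_support[of _ "2 * n" k "n + k"])
      (auto simp: plane_rotations_def c_def s_def)
  then have e2: "- s * x $ k + c * x $ (n + k) = z * x $ (n + k)"
    using k x(1) by (simp add: eig)
  have e1': "(z - c) * x $ k = s * x $ (n + k)" and e2': "(z - c) * x $ (n + k) = - s * x $ k"
    by (simp_all only: left_diff_distrib flip: e1 e2) simp_all
  \<comment> \<open>Applying z - c twice returns to the same coordinate with factor -s^2, which
    decouples the two equations.\<close>
  have "(z - c)\<^sup>2 * x $ k = s * ((z - c) * x $ (n + k))"
    by (simp only: power2_eq_square mult.assoc e1' mult.left_commute)
  moreover have "(z - c)\<^sup>2 * x $ (n + k) = - s * ((z - c) * x $ k)"
    by (simp only: power2_eq_square mult.assoc e2' mult.left_commute)
  ultimately have "((z - c)\<^sup>2 + s\<^sup>2) * x $ k = 0" "((z - c)\<^sup>2 + s\<^sup>2) * x $ (n + k) = 0"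
    by (simp_all only: e1' e2' distrib_right) (simp_all add: power2_eq_square)
  with nz have "(z - c)\<^sup>2 + s\<^sup>2 = 0" by auto
  then have "(z - (c + \<i> * s)) * (z - (c - \<i> * s)) = 0"
    by (simp add: algebra_simps power2_eq_square)
  moreover have "c + \<i> * s = cis (\<phi> k)" "c - \<i> * s = cis (- \<phi> k)"
    by (auto simp: c_def s_def complex_eq_iff)
  ultimately have "z = cis (\<phi> k) \<or> z = cis (- \<phi> k)" by auto
  with k show "z \<in> (\<lambda>k. cis (\<phi> k)) ` {..<n} \<union> (\<lambda>k. cis (- \<phi> k)) ` {..<n}" by auto
qed

text \<open>Pigeonhole: each image has at most n elements, so 2n values leave no room for a
  coincidence within \<open>f\<close> or between \<open>f\<close> and \<open>g\<close>. This turns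
  the cardinality of the spectrum into the distinctness of the numbers \<open>cis (\<phi> k)\<close>
  and their conjugates.\<close>

lemma card_image_Un_full:
  assumes "n + n \<le> card (f ` {..<n :: nat} \<union> g ` {..<n})"
  shows "inj_on f {..<n}" and "f ` {..<n} \<inter> g ` {..<n} = {}"
proof -
  have le: "card (f ` {..<n}) \<le> n" "card (g ` {..<n}) \<le> n"
    using card_image_le[of "{..<n}"] by (metis card_lessThan finite_lessThan)+
  have sum: "card (f ` {..<n}) + card (g ` {..<n})
    = card (f ` {..<n} \<union> g ` {..<n}) + card (f ` {..<n} \<inter> g ` {..<n})"
    by (rule card_Un_Int) auto
  have "card (f ` {..<n}) = n" using le sum assms by linarith
  then show "inj_on f {..<n}" by (simp add: eq_card_imp_inj_on)
  have "card (f ` {..<n} \<inter> g ` {..<n}) = 0" using le sum assms by linarith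
  then show "f ` {..<n} \<inter> g ` {..<n} = {}" by simp
qed

section \<open>Fixed 2 by 2 blocks under a pair of rotations\<close>

text \<open>Identify the real plane with the complex numbers; the rotation by s is then
  multiplication by \<open>cis (- s)\<close>. The block splits into a complex linear and an
  antilinear part, and the antilinear one is conjugation followed by multiplication by half of
  \<open>Complex (a - d) (b + c)\<close>. Conjugation also inverts the factor coming from t, hence
  the product \<open>cis (- s) * cis (- t)\<close>.\<close>

lemma rotation_fixed_block_anticonformal:
  fixes a b c d s t :: real
  assumes "a = cos t * (cos s * a + sin s * c) + sin t * (cos s * b + sin s * d)"
    and "b = - sin t * (cos s * a + sin s * c) + cos t * (cos s * b + sin s * d)"
    and "c = cos t * (- sin s * a + cos s * c) + sin t * (- sin s * b + cos s * d)"
    and "d = - sin t * (- sin s * a + cos s * c) + cos t * (- sin s * b + cos s * d)"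
    and "cis s \<noteq> cis (- t)"
  shows "a = d" and "b = - c"
proof -
  have "Complex (a - d) (b + c) = cis (- s) * cis (- t) * Complex (a - d) (b + c)"
  proof (rule complex_eqI)
    \<comment> \<open>The assumptions have the unknowns on both sides and would loop as rewrite
      rules; \<open>arg_cong2\<close> substitutes them exactly once.\<close>
    show "Re (Complex (a - d) (b + c)) = Re (cis (- s) * cis (- t) * Complex (a - d) (b + c))"
      by (simp, rule trans[OF arg_cong2[OF assms(1,4), of "(-)"]]) (simp add: algebra_simps)
    show "Im (Complex (a - d) (b + c)) = Im (cis (- s) * cis (- t) * Complex (a - d) (b + c))"
      by (simp, rule trans[OF arg_cong2[OF assms(2,3), of "(+)"]]) (simp add: algebra_simps)
  qed
  moreover have "cis (- s) * cis (- t) \<noteq> 1"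
  proof
    assume "cis (- s) * cis (- t) = 1"
    then have "cis s * (cis (- s) * cis (- t)) = cis s" by simp
    then show False using assms(5) by (simp add: cis_mult)
  qed
  ultimately have "Complex (a - d) (b + c) = 0" by simp
  then show "a = d" "b = - c" by (simp_all add: complex_eq_iff)
qed

text \<open>The counterpart for the complex linear part, which is multiplication by half of
  \<open>Complex (a + d) (c - b)\<close>. Here t enters without conjugation, so the factor is
  \<open>cis (- s) * cis t\<close>.\<close>

lemma rotation_fixed_block_conformal:
  fixes a b c d s t :: real
  assumes "a = cos t * (cos s * a + sin s * c) + sin t * (cos s * b + sin s * d)"
    and "b = - sin t * (cos s * a + sin s * c) + cos t * (cos s * b + sin s * d)"
    and "c = cos t * (- sin s * a + cos s * c) + sin t * (- sin s * b + cos s * d)"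
    and "d = - sin t * (- sin s * a + cos s * c) + cos t * (- sin s * b + cos s * d)"
    and "cis s \<noteq> cis t"
  shows "a = - d" and "b = c"
proof -
  have "Complex (a + d) (c - b) = cis (- s) * cis t * Complex (a + d) (c - b)"
  proof (rule complex_eqI)
    show "Re (Complex (a + d) (c - b)) = Re (cis (- s) * cis t * Complex (a + d) (c - b))"
      by (simp, rule trans[OF arg_cong2[OF assms(1,4), of "(+)"]]) (simp add: algebra_simps)
    show "Im (Complex (a + d) (c - b)) = Im (cis (- s) * cis t * Complex (a + d) (c - b))"
      by (simp, rule trans[OF arg_cong2[OF assms(3,2), of "(-)"]]) (simp add: algebra_simps)
  qed
  moreover have "cis (- s) * cis t \<noteq> 1"
  proof
    assume "cis (- s) * cis t = 1"
    then have "cis s * (cis (- s) * cis t) = cis s" by simp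
    then show False using assms(5) by (simp add: cis_mult)
  qed
  ultimately have "Complex (a + d) (c - b) = 0" by simp
  then show "a = - d" "b = c" by (simp_all add: complex_eq_iff)
qed

section \<open>Symmetric matrices fixed by the normal form\<close>

lemma double_diag_carrier [simp]: "double_diag n b \<in> carrier_mat (2 * n) (2 * n)"
  by (simp add: double_diag_def mult_2)

lemma double_diag_entries:
  assumes "j < n" "k < n"
  shows "double_diag n b $$ (j, k) = (if j = k then b j else 0)"
    and "double_diag n b $$ (j, n + k) = 0"
    and "double_diag n b $$ (n + j, k) = 0"
    and "double_diag n b $$ (n + j, n + k) = (if j = k then b j else 0)"
  using assms by (auto simp: double_diag_def mat_diag_def)

lemma eq_mat_blocksI:
  assumes "A \<in> carrier_mat (2 * n) (2 * n)" "B \<in> carrier_mat (2 * n) (2 * n)"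
    and "\<And>j k. j < n \<Longrightarrow> k < n \<Longrightarrow> A $$ (j, k) = B $$ (j, k)
      \<and> A $$ (j, n + k) = B $$ (j, n + k) \<and> A $$ (n + j, k) = B $$ (n + j, k)
      \<and> A $$ (n + j, n + k) = B $$ (n + j, n + k)"
  shows "A = B"
proof (rule eq_matI)
  fix i l assume "i < dim_row B" "l < dim_col B"
  then have il: "i < 2 * n" "l < 2 * n" using assms by auto
  have split: "\<exists>j<n. m = j \<or> m = n + j" if "m < 2 * n" for m
    using that by (cases "m < n") (auto intro: exI[of _ "m - n"])
  from split[OF il(1)] split[OF il(2)] assms(3) show "A $$ (i, l) = B $$ (i, l)" by auto
qed (use assms in auto)

text \<open>\<open>disj\<close> is applied to all pairs (j, k), and for j = k it says that
  \<open>cis (\<phi> k)\<close> is not real; \<open>inj\<close> is applied for j \<noteq> k.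
  Conversely, scalar blocks commute with rotations.\<close>

lemma plane_rotations_congruence_fixed_iff:
  fixes H :: "real mat"
  assumes H: "H \<in> carrier_mat (2 * n) (2 * n)" and sym: "transpose_mat H = H"
    and inj: "inj_on (\<lambda>k. cis (\<phi> k)) {..<n}"
    and disj: "(\<lambda>k. cis (\<phi> k)) ` {..<n} \<inter> (\<lambda>k. cis (- \<phi> k)) ` {..<n} = {}"
  shows "plane_rotations n \<phi> * H * transpose_mat (plane_rotations n \<phi>) = H
    \<longleftrightarrow> (\<exists>b. H = double_diag n b)"
proof
  let ?R = "plane_rotations n \<phi>"
  assume fixed: "?R * H * transpose_mat ?R = H"
  have "H = double_diag n (\<lambda>k. H $$ (k, k))"
  proof (rule eq_mat_blocksI[of _ n])
    fix j k assume jk: "j < n" "k < n"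
    note entries = plane_rotations_congruence_entries[OF H jk, of \<phi>, unfolded fixed]
    have "cis (\<phi> j) \<noteq> cis (- \<phi> k)" using disj jk by blast
    note anti = rotation_fixed_block_anticonformal[OF entries this]
    show "H $$ (j, k) = double_diag n (\<lambda>k. H $$ (k, k)) $$ (j, k)
      \<and> H $$ (j, n + k) = double_diag n (\<lambda>k. H $$ (k, k)) $$ (j, n + k)
      \<and> H $$ (n + j, k) = double_diag n (\<lambda>k. H $$ (k, k)) $$ (n + j, k)
      \<and> H $$ (n + j, n + k) = double_diag n (\<lambda>k. H $$ (k, k)) $$ (n + j, n + k)"
    proof (cases "j = k")
      case True
      \<comment> \<open>The off-diagonal entries of this block are opposite by \<open>anti\<close>
        and equal by symmetry, so both vanish.\<close>
      have "transpose_mat H $$ (j, n + j) = H $$ (n + j, j)" using H jk by simp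
      with sym have "H $$ (j, n + j) = H $$ (n + j, j)" by simp
      with anti True jk show ?thesis by (simp add: double_diag_entries)
    next
      case False
      then have "cis (\<phi> j) \<noteq> cis (\<phi> k)" using inj jk by (auto dest: inj_onD)
      note conf = rotation_fixed_block_conformal[OF entries this]
      from anti conf False jk show ?thesis by (simp add: double_diag_entries)
    qed
  qed (use H in simp_all)
  then show "\<exists>b. H = double_diag n b" by blast
next
  let ?R = "plane_rotations n \<phi>"
  assume "\<exists>b. H = double_diag n b"
  then obtain b where b: "H = double_diag n b" by blast
  \<comment> \<open>These are the diagonal entries of a rotated scalar block, in the two orders in
    which they arise for its upper and lower row.\<close>
  have pyth: "cos t * (cos t * x) + sin t * (sin t * x) = x"
    "sin t * (sin t * x) + cos t * (cos t * x) = x" for t x :: real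
    by (simp_all flip: mult.assoc distrib_right power2_eq_square)
  have RHR: "?R * H * transpose_mat ?R \<in> carrier_mat (2 * n) (2 * n)"
    using H by (intro mult_carrier_mat[of _ _ "2 * n"]) auto
  show "?R * H * transpose_mat ?R = H"
    by (rule eq_mat_blocksI[of _ n])
      (use H RHR in \<open>simp_all add: plane_rotations_congruence_entries b double_diag_entries pyth
        del: index_mult_mat\<close>)
qed

section \<open>Change of coordinates by congruence\<close>

text \<open>Transposing \<open>W * V = 1\<^sub>m m\<close> cancels the factors on the right as well.
  Used again with \<open>V\<close> and \<open>W\<close> exchanged, it makes congruence by
  \<open>V\<close> a bijection.\<close>

lemma congruence_cancel:
  assumes "V \<in> carrier_mat m m" "W \<in> carrier_mat m m" "W * V = 1\<^sub>m m" "X \<in> carrier_mat m m"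
  shows "W * (V * X * transpose_mat V) * transpose_mat W = (X :: 'a :: comm_ring_1 mat)"
proof -
  have "W * (V * X * transpose_mat V) * transpose_mat W
    = (W * V) * X * (transpose_mat V * transpose_mat W)"
    using assms(1,2,4) by (simp add: assoc_mult_mat[of _ m m _ m _ m])
  also have "transpose_mat V * transpose_mat W = 1\<^sub>m m"
    using assms by (metis transpose_mult transpose_one)
  finally show ?thesis using assms by simp
qed

lemma congruence_mult:
  assumes "A \<in> carrier_mat m m" "B \<in> carrier_mat m m" "X \<in> carrier_mat m m"
  shows "(A * B) * X * transpose_mat (A * B)
    = A * (B * X * transpose_mat B) * transpose_mat (A :: 'a :: comm_ring_1 mat)"
  using assms by (simp add: transpose_mult[of _ m m] assoc_mult_mat[of _ m m _ m _ m])

theorem mainTheorem2: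
  fixes n :: nat and M V G :: "real mat"
  assumes "M \<in> Sp n"
    and "diagonalizable (map_mat complex_of_real M)"
    and "card (spectrum (map_mat complex_of_real M)) = 2 * n"
    and "\<forall>z \<in> spectrum (map_mat complex_of_real M). cmod z = 1"
    and "linear_normal_form_map n M V"
    and "G \<in> carrier_mat (2 * n) (2 * n)"
    and "transpose_mat G = G"
  shows "M * G * transpose_mat M = G \<longleftrightarrow>
    (\<exists>b :: nat \<Rightarrow> real. G = V * double_diag n b * transpose_mat V)"
proof -
  define W where "W = mat_inv V"
  have M: "M \<in> carrier_mat (2 * n) (2 * n)" using assms(1) by (simp add: Sp_def)
  have VSp: "V \<in> Sp n" using assms(5) by (simp add: linear_normal_form_map_def)
  then have V: "V \<in> carrier_mat (2 * n) (2 * n)" by (simp add: Sp_def)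
  have W: "W \<in> carrier_mat (2 * n) (2 * n)" and WV: "W * V = 1\<^sub>m (2 * n)"
    and VW: "V * W = 1\<^sub>m (2 * n)"
    using Sp_mat_inv[OF VSp] by (simp_all add: W_def)
  from assms(5) obtain \<phi> where "\<And>k. k < n \<Longrightarrow> rotates_plane n (W * M * V) k (\<phi> k)"
    unfolding linear_normal_form_map_def W_def by metis
  then have WMV: "W * M * V = plane_rotations n \<phi>"
    using V W M by (intro eq_plane_rotationsI) auto
  let ?R = "plane_rotations n \<phi>"
  have R: "?R \<in> carrier_mat (2 * n) (2 * n)" by simp
  have "V * ?R * W = (V * W) * M * (V * W)"
    using V W M by (simp add: assoc_mult_mat[of _ "2 * n" "2 * n" _ "2 * n" _ "2 * n"] flip: WMV)
  then have MVRW: "M = V * ?R * W" using M VW by simp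

  \<comment> \<open>The similarity is real while the spectrum is complex; the real characteristic
    polynomial, mapped to complex coefficients, carries the one to the other.\<close>
  have "similar_mat M ?R"
    using M V W R by (intro similar_matI[OF _ VW WV MVRW]) simp
  then have "char_poly M = char_poly ?R" by (rule char_poly_similar)
  then have "char_poly (map_mat complex_of_real M) = char_poly (map_mat complex_of_real ?R)"
    using of_real_hom.char_poly_hom[OF M] of_real_hom.char_poly_hom[OF R] by metis
  then have "spectrum (map_mat complex_of_real M) = spectrum (map_mat complex_of_real ?R)"
    using M R by (auto simp: spectrum_def eigenvalue_root_char_poly[of _ "2 * n"])
  \<comment> \<open>The 2n eigenvalues of \<open>M\<close> all lie among the numbers
    \<open>cis (\<phi> k)\<close> and \<open>cis (- \<phi> k)\<close>, so this union has at least 2n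
    elements.\<close>
  with spectrum_plane_rotations[of n \<phi>] assms(3)
  have "n + n \<le> card ((\<lambda>k. cis (\<phi> k)) ` {..<n} \<union> (\<lambda>k. cis (- \<phi> k)) ` {..<n})"
    by (metis card_mono finite_UnI finite_imageI finite_lessThan mult_2)
  note distinct = card_image_Un_full[OF this]

  define H where "H = W * G * transpose_mat W"
  have H: "H \<in> carrier_mat (2 * n) (2 * n)" using W assms(6) by (auto simp: H_def)
  have sym: "transpose_mat H = H"
    using W assms(6,7)
    by (simp add: H_def transpose_mult[of _ "2 * n" "2 * n" _ "2 * n"]
      assoc_mult_mat[of _ "2 * n" "2 * n" _ "2 * n" _ "2 * n"])
  \<comment> \<open>Everything passes to the coordinates of \<open>V\<close> through this
    equivalence: \<open>X\<close> is taken to be \<open>H\<close> itself, then the rotated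
    \<open>H\<close>, and finally \<open>double_diag n b\<close>.\<close>
  have GH: "G = V * X * transpose_mat V \<longleftrightarrow> H = X" if X: "X \<in> carrier_mat (2 * n) (2 * n)" for X
    unfolding H_def
    using congruence_cancel[OF V W WV X] congruence_cancel[OF W V VW assms(6)] by metis
  have G: "G = V * H * transpose_mat V" using GH[OF H] by simp
  have RHR: "?R * H * transpose_mat ?R \<in> carrier_mat (2 * n) (2 * n)"
    using H by (intro mult_carrier_mat[of _ _ "2 * n"]) auto
  have MGM: "M * G * transpose_mat M = V * (?R * H * transpose_mat ?R) * transpose_mat V"
  proof -
    have "M * G * transpose_mat M = (V * ?R) * H * transpose_mat (V * ?R)"
      unfolding MVRW H_def using V W R assms(6) by (intro congruence_mult) auto
    then show ?thesis using congruence_mult[OF V R H] by simp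
  qed
  have "M * G * transpose_mat M = G \<longleftrightarrow> H = ?R * H * transpose_mat ?R"
    using GH[OF RHR] unfolding MGM by metis
  also have "\<dots> \<longleftrightarrow> (\<exists>b. H = double_diag n b)"
    using plane_rotations_congruence_fixed_iff[OF H sym distinct] by auto
  also have "\<dots> \<longleftrightarrow> (\<exists>b. G = V * double_diag n b * transpose_mat V)"
    using GH by simp
  finally show ?thesis .
qed

end
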